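(* Let $p$ be a prime and let $A$ be an $n \times n$ matrix with integer entries. Let $r = \operatorname{rank}(A)$ be its rank over $\mathbb{Z}$ and $r_0 = \operatorname{rank}_p(A)$ its rank over $\mathbb{Z}/p\mathbb{Z}$, and assume $n > p^{r_0}$. Then (i) $\operatorname{rank}(A \operatorname{rem} p) \le \dfrac{(p^{r_0} - 1)(p + 1)}{2(p-1)}$; (ii) $\operatorname{rank}(A \operatorname{quo} p) \le r + \dfrac{(p^{r_0} - 1)(p + 1)}{2(p-1)}$.
   Context: For an integer $m$ and a prime $p$, $m \operatorname{rem} p$ and $m \operatorname{quo} p$ denote the remainder and quotient in the Euclidean division $m = qp + s$ with $0 \le s < p$ (so $m \operatorname{rem} p = s$, $m \operatorname{quo} p = q$). These operations are applied entrywise to integer matrices. $\operatorname{rank}(X)$ denotes the rank of an integer matrix $X$ over $\mathbb{Z}$ (equivalently over $\mathbb{Q}$), and $\operatorname{rank}_p(X)$ denotes the rank of the image of $X$ over the field $\mathbb{Z}/p\mathbb{Z}$. *)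

theory Defs
  imports "Jordan_Normal_Form.DL_Rank" "Berlekamp_Zassenhaus.Finite_Field"
begin

definition rem_mat :: "int mat \<Rightarrow> nat \<Rightarrow> int mat" where
  "rem_mat A p = map_mat (\<lambda>m. m mod int p) A"

definition quo_mat :: "int mat \<Rightarrow> nat \<Rightarrow> int mat" where
  "quo_mat A p = map_mat (\<lambda>m. m div int p) A"

text \<open>The numeric argument of \<^const>\<open>vec_space.rank\<close> is the length of the columns, that is, the
  number of rows of the matrix.\<close>

definition rank_int :: "int mat \<Rightarrow> nat" where
  "rank_int A = vec_space.rank (dim_row A) (map_mat of_int A :: rat mat)"

text \<open>The field with \<open>p\<close> elements is the type \<^typ>\<open>'p mod_ring\<close>, where \<open>'p\<close> is a type of prime
  cardinality \<open>p\<close>.\<close>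

definition rank_mod :: "'p :: prime_card itself \<Rightarrow> int mat \<Rightarrow> nat" where
  "rank_mod _ A = vec_space.rank (dim_row A) (map_mat of_int A :: 'p mod_ring mat)"

end

theory Submission
  imports Defs
begin

text \<open>The columns of \<open>A rem p\<close> are lifts of vectors of the column space \<open>W\<close> of \<open>A\<close> modulo \<open>p\<close>,
  which has \<open>p^r0\<close> elements. The nonzero vectors of \<open>W\<close> fall into \<open>(p^r0 - 1)/(p - 1)\<close>
  punctured lines. As \<open>x rem p + (-x) rem p\<close> is \<open>p\<close> if \<open>x\<close> is nonzero modulo \<open>p\<close> and \<open>0\<close> otherwise,
  the lifts of the multiples of \<open>v\<close> are spanned by those of \<open>k v\<close> with \<open>0 < k < p/2\<close> together
  with the indicator of the support of \<open>v\<close>, that is, by at most \<open>(p + 1)/2\<close> vectors.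
  The second bound follows because \<open>A quo p = (A - A rem p)/p\<close>.\<close>

section \<open>Rank through spanning sets of the columns, and the size of a span over a finite
  field\<close>

context vec_space
begin

text \<open>A maximal independent set of columns lies in the span of \<open>S\<close>. That span is
  treated as a vector space of its own, since \<open>S\<close> generates it but perhaps not the
  whole space; there independent sets are no larger than generating ones.\<close>

lemma rank_le_card_spanning_set:
  assumes A: "A \<in> carrier_mat n nc"
    and fin: "finite S" and S: "S \<subseteq> carrier_vec n"
    and cols: "set (cols A) \<subseteq> span S"
  shows "rank A \<le> card S"
proof -
  obtain U where U: "maximal U (\<lambda>T. T \<subseteq> set (cols A) \<and> lin_indpt T)" and finU: "finite U"
    using maximal_exists_superset[of "set (cols A)" "\<lambda>T. T \<subseteq> set (cols A) \<and> lin_indpt T" "{}"]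
      finite_lin_indpt2[of "{}"] by auto
  have US: "U \<subseteq> span S" and liU: "lin_indpt U"
    using U cols unfolding maximal_def by auto
  have sub: "submodule class_ring (span S) V"
    using span_is_submodule S by simp
  interpret W: vectorspace class_ring "vs (span S)"
    using field.field_axioms vectorspace_def submodule_is_module[OF sub] by metis
  have SS: "S \<subseteq> span S" using in_own_span S by simp
  have gen: "LinearCombinations.module.span class_ring (vs (span S)) S = span S"
    using span_li_not_depend(1)[OF SS sub] by simp
  have li: "W.lin_indpt U"
    using span_li_not_depend(2)[OF US sub] liU by simp
  have "W.fin_dim" unfolding W.fin_dim_def using fin SS gen by auto
  then have "card U \<le> W.dim" using W.li_le_dim(2) US li by simp
  also have "\<dots> \<le> card S" using W.gen_ge_dim fin SS gen by simp
  finally show ?thesis using rank_card_indpt[OF A U] by simp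
qed

text \<open>A maximal independent set of columns works: a column outside its span could be adjoined
  without losing independence.\<close>

lemma spanning_set_of_card_rank:
  assumes A: "A \<in> carrier_mat n nc"
  obtains S where "finite S" "S \<subseteq> carrier_vec n" "card S = rank A" "set (cols A) \<subseteq> span S"
proof -
  obtain U where U: "maximal U (\<lambda>T. T \<subseteq> set (cols A) \<and> lin_indpt T)" and finU: "finite U"
    using maximal_exists_superset[of "set (cols A)" "\<lambda>T. T \<subseteq> set (cols A) \<and> lin_indpt T" "{}"]
      finite_lin_indpt2[of "{}"] by auto
  have carr: "set (cols A) \<subseteq> carrier_vec n" using cols_dim A by blast
  have Uc: "U \<subseteq> set (cols A)" and liU: "lin_indpt U" using U unfolding maximal_def by auto
  have "s \<in> span U" if s: "s \<in> set (cols A)" for s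
  proof (rule ccontr)
    assume ns: "s \<notin> span U"
    have "lin_indpt (U \<union> {s})"
      using ns liU Uc carr s lin_dep_iff_in_span[of U s] span_mem[of U s] by auto
    then have "U \<union> {s} = U" using U s Uc unfolding maximal_def by blast
    then show False using ns Uc carr span_mem[of U s] by auto
  qed
  then show thesis
    using that[of U] finU Uc carr rank_card_indpt[OF A U] by auto
qed

lemma card_span_le:
  assumes "finite (UNIV :: 'a set)" "finite S" "S \<subseteq> carrier_vec n"
  shows "finite (span S) \<and> card (span S) \<le> CARD('a) ^ card S"
proof -
  have sub: "span S \<subseteq> (\<lambda>a. lincomb a S) ` (S \<rightarrow>\<^sub>E UNIV)"
  proof
    fix v assume "v \<in> span S"
    then obtain a where v: "v = lincomb a S"
      using finite_span assms by auto
    \<comment> \<open>Only the coefficients on \<open>S\<close> matter, so extensional functions, of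
      which there are finitely many, reach the whole span.\<close>
    have "lincomb (restrict a S) S = lincomb a S"
      by (rule lincomb_cong) (use assms in auto)
    then show "v \<in> (\<lambda>a. lincomb a S) ` (S \<rightarrow>\<^sub>E UNIV)"
      unfolding v by (intro image_eqI[of _ _ "restrict a S"]) auto
  qed
  have fin: "finite (S \<rightarrow>\<^sub>E (UNIV :: 'a set))" using assms by (intro finite_PiE) auto
  have "card (span S) \<le> card (S \<rightarrow>\<^sub>E (UNIV :: 'a set))"
    using surj_card_le[OF fin sub] .
  also have "\<dots> = CARD('a) ^ card S" using assms by (simp add: card_PiE)
  finally show ?thesis using finite_subset[OF sub] fin by auto
qed

end

section \<open>Lifts of the multiples of a single vector\<close>

definition lift_vec :: "'p :: prime_card mod_ring vec \<Rightarrow> rat vec" where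
  "lift_vec v = map_vec (\<lambda>x. of_int (to_int_mod_ring x)) v"

definition supp_vec :: "'p :: prime_card mod_ring vec \<Rightarrow> rat vec" where
  "supp_vec v = map_vec (\<lambda>x. if x = 0 then 0 else 1) v"

text \<open>The strict bound \<open>2 * k < CARD('p)\<close> leaves out the residue p/2, which
  occurs only for p = 2 and is then covered by the support vector.\<close>

definition line_gens :: "'p :: prime_card mod_ring vec \<Rightarrow> rat vec set" where
  "line_gens v = insert (supp_vec v)
     ((\<lambda>k. lift_vec (of_nat k \<cdot>\<^sub>v v)) ` {k. 0 < k \<and> 2 * k < CARD('p)})"

lemma lift_vec_carrier [simp]: "lift_vec v \<in> carrier_vec n \<longleftrightarrow> v \<in> carrier_vec n"
  by (simp add: lift_vec_def)

lemma supp_vec_carrier [simp]: "supp_vec v \<in> carrier_vec n \<longleftrightarrow> v \<in> carrier_vec n"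
  by (simp add: supp_vec_def)

lemma line_gens_carrier: "v \<in> carrier_vec n \<Longrightarrow> line_gens v \<subseteq> carrier_vec n"
  by (auto simp: line_gens_def)

text \<open>There are floor((p - 1)/2) such residues; the bound is an equality for odd p.\<close>

lemma card_half_residues:
  fixes p :: nat
  assumes "p > 0"
  shows "finite {k. 0 < k \<and> 2 * k < p}" "2 * card {k. 0 < k \<and> 2 * k < p} + 1 \<le> p"
proof -
  have eq: "{k. 0 < k \<and> 2 * k < p} = {1..(p - 1) div 2}" using assms by auto
  show "finite {k. 0 < k \<and> 2 * k < p}" "2 * card {k. 0 < k \<and> 2 * k < p} + 1 \<le> p"
    unfolding eq using assms by auto
qed

lemma card_line_gens:
  fixes v :: "'p :: prime_card mod_ring vec"
  shows "finite (line_gens v)" "2 * card (line_gens v) \<le> CARD('p) + 1"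
proof -
  let ?K = "{k. 0 < k \<and> 2 * k < CARD('p)}"
  have p: "CARD('p) > 0" by simp
  note K = card_half_residues[OF p]
  show "finite (line_gens v)" unfolding line_gens_def using K(1) by simp
  have "card (line_gens v) \<le> Suc (card ?K)"
    unfolding line_gens_def
    by (rule order_trans[OF card_insert_le_m1[of "Suc (card ?K)"]])
      (use card_image_le[OF K(1)] in auto)
  then show "2 * card (line_gens v) \<le> CARD('p) + 1" using K(2) by linarith
qed

lemma to_int_mod_ring_uminus:
  fixes x :: "'p :: prime_card mod_ring"
  shows "to_int_mod_ring (- x) = (if x = 0 then 0 else int CARD('p) - to_int_mod_ring x)"
  by transfer auto

text \<open>Since \<open>c\<close> is nonzero, all these multiples have the same support as
  \<open>v\<close>, so one indicator vector serves the whole line.\<close>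

lemma lift_vec_uminus:
  fixes v :: "'p :: prime_card mod_ring vec"
  assumes "c \<noteq> 0"
  shows "lift_vec (c \<cdot>\<^sub>v v) = of_nat CARD('p) \<cdot>\<^sub>v supp_vec v + (-1) \<cdot>\<^sub>v lift_vec ((- c) \<cdot>\<^sub>v v)"
  using assms
  by (intro eq_vecI)
    (auto simp: lift_vec_def supp_vec_def to_int_mod_ring_uminus to_int_mod_ring_hom.hom_zero)

lemma lift_vec_smult_in_span:
  fixes v :: "'p :: prime_card mod_ring vec"
  assumes v: "v \<in> carrier_vec n" and c: "c \<noteq> 0"
  shows "lift_vec (c \<cdot>\<^sub>v v) \<in> LinearCombinations.module.span class_ring
           (module_vec TYPE(rat) n) (line_gens v)"
proof -
  interpret V: vec_space "TYPE(rat)" n .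
  let ?p = "CARD('p)"
  have G: "line_gens v \<subseteq> carrier_vec n" using line_gens_carrier v .
  have supp: "supp_vec v \<in> V.span (line_gens v)"
    using V.span_mem[of "line_gens v"] G by (auto simp: line_gens_def)
  have gens: "lift_vec (of_nat k \<cdot>\<^sub>v v) \<in> V.span (line_gens v)" if "0 < k" "2 * k < ?p" for k
    using V.span_mem[of "line_gens v"] G that by (auto simp: line_gens_def)
  obtain k where k: "k < ?p" "c = of_nat k" using surj_of_nat_mod_ring by blast
  have k0: "k > 0" using c k by (cases k) auto
  \<comment> \<open>The negative is written as a natural number multiple so that \<open>gens\<close>
    can apply to it when k exceeds p/2.\<close>
  have neg: "- c = of_nat (?p - k)" using k by (simp add: of_nat_diff)
  \<comment> \<open>Either k or p - k lies below p/2, or both equal p/2. The last case is that of p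
    = 2.\<close>
  consider "2 * k < ?p" | "2 * (?p - k) < ?p" | "?p - k = k" using k by linarith
  then show ?thesis
  proof cases
    case 1
    then show ?thesis using gens k0 k by auto
  next
    case 2
    have "lift_vec ((- c) \<cdot>\<^sub>v v) \<in> V.span (line_gens v)"
      unfolding neg by (rule gens) (use 2 k in auto)
    then show ?thesis unfolding lift_vec_uminus[OF c]
      using supp G by (intro V.span_add1 V.smult_in_span) auto
  next
    case 3
    \<comment> \<open>Here c = -c, so the relation between opposite lifts says that twice the lift
      is p times the support vector.\<close>
    have "lift_vec (c \<cdot>\<^sub>v v) = (of_nat ?p / 2) \<cdot>\<^sub>v supp_vec v"
    proof -
      have cc: "- c = c" using neg k 3 by simp
      let ?w = "lift_vec (c \<cdot>\<^sub>v v)"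
      have e: "?w = of_nat ?p \<cdot>\<^sub>v supp_vec v + (-1) \<cdot>\<^sub>v ?w"
        using lift_vec_uminus[OF c, of v] unfolding cc .
      show ?thesis
      proof (rule eq_vecI)
        fix i assume "i < dim_vec ((of_nat ?p / 2) \<cdot>\<^sub>v supp_vec v)"
        then have i: "i < dim_vec v" by (simp add: supp_vec_def)
        have "?w $ i = (of_nat ?p \<cdot>\<^sub>v supp_vec v + (-1) \<cdot>\<^sub>v ?w) $ i" using e by simp
        then show "?w $ i = ((of_nat ?p / 2) \<cdot>\<^sub>v supp_vec v) $ i"
          using i by (simp add: supp_vec_def lift_vec_def)
      qed (simp add: supp_vec_def lift_vec_def)
    qed
    then show ?thesis using V.smult_in_span[OF G supp] by simp
  qed
qed

section \<open>Counting generators line by line\<close>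

text \<open>At a coordinate where \<open>v\<close> is nonzero the scalar can be recovered from the
  multiple.\<close>

lemma card_nonzero_multiples:
  fixes v :: "'p :: prime_card mod_ring vec"
  assumes v: "v \<in> carrier_vec n" "v \<noteq> 0\<^sub>v n"
  shows "card ((\<lambda>c. c \<cdot>\<^sub>v v) ` (UNIV - {0})) = CARD('p) - 1"
proof -
  have "\<exists>i<n. v $ i \<noteq> 0"
  proof (rule ccontr)
    assume "\<not> (\<exists>i<n. v $ i \<noteq> 0)"
    then have "v = 0\<^sub>v n" using v(1) by (intro eq_vecI) auto
    then show False using v(2) by simp
  qed
  then obtain i where i: "i < n" "v $ i \<noteq> 0" by blast
  have "inj_on (\<lambda>c. c \<cdot>\<^sub>v v) (UNIV - {0})"
  proof (rule inj_onI)
    fix c d assume "c \<cdot>\<^sub>v v = d \<cdot>\<^sub>v v"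
    then have "(c \<cdot>\<^sub>v v) $ i = (d \<cdot>\<^sub>v v) $ i" by simp
    then show "c = d" using i v by simp
  qed
  then show ?thesis by (simp add: card_image card_Diff_singleton)
qed

text \<open>Removing one punctured line takes away p - 1 vectors and costs at most (p + 1)/2
  generators. \<open>U\<close> is any union of punctured lines, because a punctured subspace would
  not keep its form under this removal. The bound is cleared of denominators to stay within the
  naturals.\<close>

lemma lift_vec_spanning_set:
  fixes U :: "'p :: prime_card mod_ring vec set"
  assumes "finite U" "U \<subseteq> carrier_vec n" "0\<^sub>v n \<notin> U"
    and "\<And>v c. v \<in> U \<Longrightarrow> c \<noteq> 0 \<Longrightarrow> c \<cdot>\<^sub>v v \<in> U"
  shows "\<exists>S. finite S \<and> S \<subseteq> carrier_vec n \<and>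
           lift_vec ` U \<subseteq> LinearCombinations.module.span class_ring (module_vec TYPE(rat) n) S \<and>
           2 * (CARD('p) - 1) * card S \<le> (CARD('p) + 1) * card U"
  using assms
proof (induction U rule: finite_psubset_induct)
  case (psubset U)
  interpret V: vec_space "TYPE(rat)" n .
  let ?p = "CARD('p)"
  show ?case
  proof (cases "U = {}")
    case True
    then show ?thesis by (intro exI[of _ "{}"]) auto
  next
    case False
    then obtain v where v: "v \<in> U" by auto
    have vc: "v \<in> carrier_vec n" "v \<noteq> 0\<^sub>v n" using v psubset.prems by auto
    define L where "L = (\<lambda>c. c \<cdot>\<^sub>v v) ` (UNIV - {0})"
    have LU: "L \<subseteq> U" using psubset.prems v unfolding L_def by auto
    have vL: "v \<in> L" unfolding L_def by (intro image_eqI[of _ _ 1]) auto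
    have cL: "card L = ?p - 1" unfolding L_def using card_nonzero_multiples vc .
    have cU: "card U = card (U - L) + (?p - 1)"
      using cL LU psubset.hyps card_mono[OF psubset.hyps LU]
      by (simp add: card_Diff_subset finite_subset)
    \<comment> \<open>Removing the line keeps closure under nonzero scalars: if a nonzero multiple
      of \<open>w\<close> were on the line of \<open>v\<close>, inverting the scalar would put
      \<open>w\<close> there too.\<close>
    have closed: "c \<cdot>\<^sub>v w \<in> U - L" if w: "w \<in> U - L" and c: "c \<noteq> 0" for w c
    proof -
      have "c \<cdot>\<^sub>v w \<notin> L"
      proof
        assume "c \<cdot>\<^sub>v w \<in> L"
        then obtain d where d: "d \<noteq> 0" "c \<cdot>\<^sub>v w = d \<cdot>\<^sub>v v" unfolding L_def by auto
        have "w = (inverse c * c) \<cdot>\<^sub>v w" using c by simp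
        also have "\<dots> = inverse c \<cdot>\<^sub>v (c \<cdot>\<^sub>v w)" by (simp only: smult_smult_assoc)
        also have "\<dots> = (inverse c * d) \<cdot>\<^sub>v v" unfolding d by (simp only: smult_smult_assoc)
        finally have "w \<in> L" unfolding L_def using c d by (intro image_eqI[of _ _ "inverse c * d"]) auto
        then show False using w by simp
      qed
      then show ?thesis using w c psubset.prems by auto
    qed
    obtain S where S: "finite S" "S \<subseteq> carrier_vec n" "lift_vec ` (U - L) \<subseteq> V.span S"
        "2 * (?p - 1) * card S \<le> (?p + 1) * card (U - L)"
    proof -
      have "U - L \<subset> U" "U - L \<subseteq> carrier_vec n" "0\<^sub>v n \<notin> U - L"
        using v vL psubset.prems(1,2) by auto
      from psubset.IH[OF this closed] that show thesis by auto
    qed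
    let ?T = "S \<union> line_gens v"
    have T: "?T \<subseteq> carrier_vec n" using S(2) line_gens_carrier[OF vc(1)] by blast
    have L: "lift_vec ` L \<subseteq> V.span (line_gens v)"
      using lift_vec_smult_in_span[OF vc(1)] unfolding L_def by auto
    have "lift_vec ` U \<subseteq> lift_vec ` (U - L) \<union> lift_vec ` L" by blast
    also have "\<dots> \<subseteq> V.span S \<union> V.span (line_gens v)" using S(3) L by (rule Un_mono)
    also have "\<dots> \<subseteq> V.span ?T"
      by (intro Un_least V.span_is_monotone) auto
    finally have 1: "lift_vec ` U \<subseteq> V.span ?T" .
    have "2 * (?p - 1) * card ?T \<le> 2 * (?p - 1) * (card S + card (line_gens v))"
      using card_Un_le by (intro mult_left_mono) auto
    also have "\<dots> = 2 * (?p - 1) * card S + (?p - 1) * (2 * card (line_gens v))"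
      by (simp only: distrib_left mult.assoc mult.left_commute)
    \<comment> \<open>The first summand is bounded by the induction hypothesis, the second by the
      size of \<open>line_gens v\<close>.\<close>
    also have "\<dots> \<le> (?p + 1) * card (U - L) + (?p - 1) * (?p + 1)"
      using S(4) card_line_gens(2)[of v] by (intro add_mono mult_left_mono) auto
    also have "\<dots> = (?p + 1) * card U" unfolding cU by (simp only: distrib_left mult.commute)
    finally show ?thesis using S T 1 card_line_gens(1)[of v] by (intro exI[of _ ?T]) auto
  qed
qed

section \<open>Spanning the columns of the remainder and of the quotient\<close>

text \<open>The conclusion provides a spanning set and not just a rank bound, because the same set
  is used again for the quotient matrix.\<close>

lemma rem_mat_spanning_set:
  fixes A :: "int mat"
  assumes A: "A \<in> carrier_mat n nc"
  shows "\<exists>S. finite S \<and> S \<subseteq> carrier_vec n \<and>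
           set (cols (map_mat of_int (rem_mat A CARD('p)))) \<subseteq>
             LinearCombinations.module.span class_ring (module_vec TYPE(rat) n) S \<and>
           2 * (CARD('p) - 1) * card S \<le>
             (CARD('p) + 1) * (CARD('p :: prime_card) ^ rank_mod TYPE('p) A - 1)"
proof -
  interpret V: vec_space "TYPE(rat)" n .
  interpret F: vec_space "TYPE('p mod_ring)" n .
  let ?p = "CARD('p)" and ?A = "map_mat of_int A :: 'p mod_ring mat"
  have Ac: "?A \<in> carrier_mat n nc" using A by simp
  obtain B where B: "finite B" "B \<subseteq> carrier_vec n" "card B = F.rank ?A"
      "set (cols ?A) \<subseteq> F.span B"
    using F.spanning_set_of_card_rank[OF Ac] .
  have finW: "finite (F.span B)" and "card (F.span B) \<le> ?p ^ card B"
    using F.card_span_le[OF _ B(1,2)] by auto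
  then have cW: "card (F.span B) \<le> ?p ^ rank_mod TYPE('p) A"
    using B(3) A by (simp add: rank_mod_def)
  \<comment> \<open>Zero lies on no punctured line and its lift is zero, hence in every span.
    Leaving it out yields the -1 in the bound.\<close>
  let ?U = "F.span B - {0\<^sub>v n}"
  have WB: "F.span B \<subseteq> carrier_vec n" using F.span_closed[of B] B by auto
  have closed: "c \<cdot>\<^sub>v v \<in> ?U" if v: "v \<in> ?U" and c: "c \<noteq> 0" for v c
  proof -
    have "v = 0\<^sub>v n" if "c \<cdot>\<^sub>v v = 0\<^sub>v n"
    proof -
      have "v = (inverse c * c) \<cdot>\<^sub>v v" using c by simp
      also have "\<dots> = inverse c \<cdot>\<^sub>v 0\<^sub>v n" using that by (simp only: smult_smult_assoc[symmetric])
      finally show ?thesis by simp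
    qed
    then show ?thesis using v F.smult_in_span[of B v c] B by auto
  qed
  obtain S where S: "finite S" "S \<subseteq> carrier_vec n" "lift_vec ` ?U \<subseteq> V.span S"
      "2 * (?p - 1) * card S \<le> (?p + 1) * card ?U"
    using lift_vec_spanning_set[of ?U n] finW WB closed by auto
  have z: "lift_vec (0\<^sub>v n :: 'p mod_ring vec) = 0\<^sub>v n"
    by (auto simp: lift_vec_def)
  have W: "lift_vec v \<in> V.span S" if "v \<in> F.span B" for v
  proof (cases "v = 0\<^sub>v n")
    case True
    then show ?thesis using z vectorspace.span_zero[OF V.vectorspace_axioms, of S]
      by (simp add: module_vec_simps)
  next
    case False
    then show ?thesis using S(3) that by blast
  qed
  have "set (cols (map_mat of_int (rem_mat A ?p))) \<subseteq> V.span S"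
  proof
    fix x assume "x \<in> set (cols (map_mat of_int (rem_mat A ?p) :: rat mat))"
    then obtain j where j: "j < nc" "x = col (map_mat of_int (rem_mat A ?p)) j"
      using A by (auto simp: cols_def rem_mat_def)
    \<comment> \<open>Reducing modulo p and then lifting is taking the remainder, so columns of the
      remainder matrix are lifts of columns of \<open>?A\<close>.\<close>
    have to_int: "to_int_mod_ring (of_int m :: 'p mod_ring) = m mod int ?p" for m
      by transfer simp
    have "x = lift_vec (col ?A j)"
      using A j by (intro eq_vecI) (auto simp: lift_vec_def rem_mat_def to_int)
    moreover have "col ?A j \<in> F.span B"
      using B(4) A j by (auto simp: cols_def)
    ultimately show "x \<in> V.span S" using W by simp
  qed
  moreover have "card ?U \<le> ?p ^ rank_mod TYPE('p) A - 1"
    using cW vectorspace.span_zero[OF F.vectorspace_axioms, of B] finW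
    by (simp add: module_vec_simps card_Diff_singleton)
  then have "2 * (?p - 1) * card S \<le> (?p + 1) * (?p ^ rank_mod TYPE('p) A - 1)"
    by (rule order_trans[OF S(4) mult_le_mono2])
  ultimately show ?thesis using S(1,2) by (intro exI[of _ S] conjI)
qed

text \<open>Each column of the quotient is a rational combination of the columns of A and of the
  remainder at the same index, so the two spanning sets together suffice.\<close>

lemma quo_mat_spanning_set:
  fixes A :: "int mat"
  assumes A: "A \<in> carrier_mat n nc" and "p > 0"
    and S: "S \<subseteq> carrier_vec n"
    and "set (cols (map_mat of_int (rem_mat A p))) \<subseteq>
           LinearCombinations.module.span class_ring (module_vec TYPE(rat) n) S"
    and T: "T \<subseteq> carrier_vec n"
    and "set (cols (map_mat of_int A)) \<subseteq>
           LinearCombinations.module.span class_ring (module_vec TYPE(rat) n) T"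
  shows "set (cols (map_mat of_int (quo_mat A p))) \<subseteq>
           LinearCombinations.module.span class_ring (module_vec TYPE(rat) n) (T \<union> S)"
proof
  interpret V: vec_space "TYPE(rat)" n .
  have TS: "T \<union> S \<subseteq> carrier_vec n" using S T by auto
  fix x assume "x \<in> set (cols (map_mat of_int (quo_mat A p) :: rat mat))"
  then obtain j where j: "j < nc" "x = col (map_mat of_int (quo_mat A p)) j"
    using A by (auto simp: cols_def quo_mat_def)
  let ?a = "col (map_mat of_int A :: rat mat) j"
  let ?b = "col (map_mat of_int (rem_mat A p) :: rat mat) j"
  have "x = (1 / of_nat p) \<cdot>\<^sub>v ?a + (- 1 / of_nat p) \<cdot>\<^sub>v ?b"
  proof (rule eq_vecI)
    fix i assume "i < dim_vec ((1 / of_nat p) \<cdot>\<^sub>v ?a + (- 1 / of_nat p) \<cdot>\<^sub>v ?b)"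
    then have i: "i < n" using A by (simp add: rem_mat_def)
    let ?m = "A $$ (i, j)"
    \<comment> \<open>Euclidean division of the entry, cast to the rationals, where it can be solved
      for the quotient.\<close>
    have "of_int ?m = (of_nat p * of_int (?m div int p) + of_int (?m mod int p) :: rat)"
      using arg_cong[OF mult_div_mod_eq[of "int p" ?m], of "of_int :: int \<Rightarrow> rat"]
      by (simp only: of_int_add of_int_mult of_int_of_nat_eq)
    then show "x $ i = ((1 / of_nat p) \<cdot>\<^sub>v ?a + (- 1 / of_nat p) \<cdot>\<^sub>v ?b) $ i"
      using i j A \<open>p > 0\<close> by (simp add: rem_mat_def quo_mat_def field_simps)
  qed (use j A in \<open>simp add: rem_mat_def quo_mat_def\<close>)
  moreover have "?a \<in> V.span (T \<union> S)"
    using assms(6) V.span_is_monotone[of T "T \<union> S"] A j by (force simp: cols_def)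
  moreover have "?b \<in> V.span (T \<union> S)"
    using assms(4) V.span_is_monotone[of S "T \<union> S"] A j by (force simp: cols_def rem_mat_def)
  ultimately show "x \<in> V.span (T \<union> S)"
    using TS by (auto intro!: V.span_add1 V.smult_in_span)
qed

theorem theorem1:
  fixes A :: "int mat" and n p r r0 :: nat
  assumes p: "p = CARD('p :: prime_card)"
    and A: "A \<in> carrier_mat n n"
    and r: "r = rank_int A"
    and r0: "r0 = rank_mod TYPE('p) A"
    and n: "n > p ^ r0"
  shows "real (rank_int (rem_mat A p))
           \<le> (real p ^ r0 - 1) * (real p + 1) / (2 * (real p - 1))
       \<and> real (rank_int (quo_mat A p))
           \<le> real r + (real p ^ r0 - 1) * (real p + 1) / (2 * (real p - 1))"
proof -
  interpret V: vec_space "TYPE(rat)" n .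
  have p1: "p > 1" unfolding p using nontriv .
  have Ac: "(map_mat of_int A :: rat mat) \<in> carrier_mat n n"
    and Rc: "(map_mat of_int (rem_mat A p) :: rat mat) \<in> carrier_mat n n"
    and Qc: "(map_mat of_int (quo_mat A p) :: rat mat) \<in> carrier_mat n n"
    using A by (auto simp: rem_mat_def quo_mat_def)
  obtain S where S: "finite S" "S \<subseteq> carrier_vec n"
      "set (cols (map_mat of_int (rem_mat A p))) \<subseteq> V.span S"
      "2 * (p - 1) * card S \<le> (p + 1) * (p ^ r0 - 1)"
    using rem_mat_spanning_set[OF A, where 'p = 'p] unfolding p r0 by blast
  obtain T where T: "finite T" "T \<subseteq> carrier_vec n" "card T = V.rank (map_mat of_int A)"
      "set (cols (map_mat of_int A)) \<subseteq> V.span T"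
    using V.spanning_set_of_card_rank[OF Ac] .
  have cT: "card T = r" using T(3) A by (simp add: r rank_int_def)
  \<comment> \<open>The bound moves to the reals; both truncated subtractions are exact there, as p
    > 1 and p^r0 is at least 1.\<close>
  have "real (2 * (p - 1) * card S) \<le> real ((p + 1) * (p ^ r0 - 1))"
    using S(4) by (simp only: of_nat_le_iff)
  moreover have "real (2 * (p - 1) * card S) = 2 * (real p - 1) * real (card S)"
    using p1 by (simp add: of_nat_diff)
  moreover have "real ((p + 1) * (p ^ r0 - 1)) = (real p + 1) * (real p ^ r0 - 1)"
    using p1 by (simp add: of_nat_diff del: mult_Suc One_nat_def)
  ultimately have bound: "real (card S) \<le> (real p ^ r0 - 1) * (real p + 1) / (2 * (real p - 1))"
    using p1 by (simp add: field_simps)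
  have "rank_int (rem_mat A p) \<le> card S"
    using V.rank_le_card_spanning_set[OF Rc S(1-3)] A by (simp add: rank_int_def rem_mat_def)
  \<comment> \<open>\<open>T\<close> accounts for the summand r and \<open>S\<close> for the bound
    already obtained for the remainder.\<close>
  moreover have "rank_int (quo_mat A p) \<le> card (T \<union> S)"
    using V.rank_le_card_spanning_set[OF Qc _ _ quo_mat_spanning_set[OF A _ S(2,3) T(2,4)]]
      S T A p1 by (simp add: rank_int_def quo_mat_def)
  then have "rank_int (quo_mat A p) \<le> r + card S"
    using card_Un_le[of T S] cT by linarith
  ultimately show ?thesis using bound by linarith
qed

end
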